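(* Let $X$ be a Stein manifold equipped with a holomorphic symplectic form $\omega$. Suppose that (i) $(X,\omega)$ has the Hamiltonian density property, and (ii) there exist complete holomorphic symplectic vector fields $\{V_j\}_{j\in J}$ on $X$, where $J$ is an index set, such that the classes $\{[V_j^\flat]\}_{j\in J}$ form a basis of $H^1_{\mathrm{dR}}(X)$. Then $(X,\omega)$ has the symplectic density property.
   Context: A holomorphic symplectic form is a closed, nowhere degenerate holomorphic $(2,0)$-form. A holomorphic vector field $V$ on $(X,\omega)$ is symplectic if the $1$-form $V^\flat:=i_V\omega$ is closed, and Hamiltonian if $i_V\omega=df$ for some holomorphic function $f$ on $X$. $\mathrm{SVF}_\omega(X)$ and $\mathrm{HVF}_\omega(X)$ denote the Lie algebras (under the commutator) of symplectic and Hamiltonian holomorphic vector fields respectively, with the topology of uniform convergence on compacts. A vector field is complete if its flow exists for all complex times from every initial point. $(X,\omega)$ has the Hamiltonian density property (resp. symplectic density property) if the Lie algebra generated by the complete holomorphic Hamiltonian (resp. symplectic) vector fields is dense in $\mathrm{HVF}_\omega(X)$ (resp. $\mathrm{SVF}_\omega(X)$). $H^1_{\mathrm{dR}}(X)$ is the first holomorphic de Rham cohomology group: closed holomorphic $1$-forms on $X$ modulo $\{df: f\in\mathcal{O}(X)\}$. *)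

theory Defs
  imports "HOL-Analysis.Analysis"
begin

section \<open>Holomorphic functions of several complex variables\<close>

text \<open>Total differentiability with complex-linear derivative; only used for open \<open>S\<close>.\<close>

definition holo_on :: "(complex^'n \<Rightarrow> complex) \<Rightarrow> (complex^'n) set \<Rightarrow> bool" where
  "holo_on f S \<longleftrightarrow>
     (\<forall>z\<in>S. \<exists>f'. (f has_derivative f') (at z) \<and> (\<forall>k u. f' (k *s u) = k * f' u))"

definition holo_map_on :: "(complex^'n \<Rightarrow> complex^'m) \<Rightarrow> (complex^'n) set \<Rightarrow> bool" where
  "holo_map_on F S \<longleftrightarrow> (\<forall>i. holo_on (\<lambda>z. F z $ i) S)"

definition partial :: "'n \<Rightarrow> (complex^'n \<Rightarrow> complex) \<Rightarrow> complex^'n \<Rightarrow> complex" where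
  "partial i f z = frechet_derivative f (at z) (axis i 1)"


section \<open>Complex manifolds\<close>

text \<open>A chart \<open>(U, \<phi>)\<close> consists of an open set and a coordinate map whose values outside \<open>U\<close> are
  irrelevant. A manifold is given by its topology \<open>X\<close> and a (not necessarily maximal) holomorphic
  atlas \<open>A\<close>. It has pure dimension \<open>CARD('n)\<close> and need not be connected.\<close>

type_synonym ('a, 'n) chart = "'a set \<times> ('a \<Rightarrow> (complex, 'n) vec)"

definition chart_inv :: "('a, 'n::finite) chart \<Rightarrow> complex^'n \<Rightarrow> 'a" where
  "chart_inv c = inv_into (fst c) (snd c)"

definition chart_image :: "('a, 'n::finite) chart \<Rightarrow> (complex^'n) set" where
  "chart_image c = snd c ` fst c"

definition is_chart :: "'a topology \<Rightarrow> ('a, 'n::finite) chart \<Rightarrow> bool" where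
  "is_chart X c \<longleftrightarrow> openin X (fst c) \<and> open (chart_image c) \<and>
     homeomorphic_map (subtopology X (fst c)) (top_of_set (chart_image c)) (snd c)"

definition complex_manifold :: "'a topology \<Rightarrow> ('a, 'n::finite) chart set \<Rightarrow> bool" where
  "complex_manifold X A \<longleftrightarrow>
     Hausdorff_space X \<and> second_countable X \<and>
     (\<forall>c\<in>A. is_chart X c) \<and> (\<Union>c\<in>A. fst c) = topspace X \<and>
     (\<forall>c\<in>A. \<forall>d\<in>A. holo_map_on (snd d \<circ> chart_inv c) (snd c ` (fst c \<inter> fst d)))"

definition charts_at :: "('a, 'n::finite) chart set \<Rightarrow> 'a \<Rightarrow> ('a, 'n) chart set" where
  "charts_at A p = {c \<in> A. p \<in> fst c}"

definition holo_functions :: "('a, 'n::finite) chart set \<Rightarrow> ('a \<Rightarrow> complex) set" where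
  "holo_functions A = {f. \<forall>c\<in>A. holo_on (f \<circ> chart_inv c) (chart_image c)}"

text \<open>Writing the bound \<open>sup\<^sub>K |f|\<close> through all upper bounds \<open>B\<close> makes the hull of the empty set empty.\<close>

definition holo_hull :: "'a topology \<Rightarrow> ('a, 'n::finite) chart set \<Rightarrow> 'a set \<Rightarrow> 'a set" where
  "holo_hull X A K = {p \<in> topspace X. \<forall>f\<in>holo_functions A. \<forall>B.
     (\<forall>q\<in>K. cmod (f q) \<le> B) \<longrightarrow> cmod (f p) \<le> B}"

definition stein_manifold :: "'a topology \<Rightarrow> ('a, 'n::finite) chart set \<Rightarrow> bool" where
  "stein_manifold X A \<longleftrightarrow> complex_manifold X A \<and>
     (\<forall>p\<in>topspace X. \<forall>q\<in>topspace X. p \<noteq> q \<longrightarrow> (\<exists>f\<in>holo_functions A. f p \<noteq> f q)) \<and>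
     (\<forall>K. compactin X K \<longrightarrow> compactin X (holo_hull X A K))"


section \<open>Tangent vectors and vector fields\<close>

text \<open>A (holomorphic) tangent vector at \<open>p\<close> is a family of coordinate vectors, one for each chart
  around \<open>p\<close>, that transforms by the derivatives of the coordinate changes. To make the
  representation unique, it is \<open>0\<close> at all other charts. Sections are likewise set to \<open>0\<close> off the
  manifold.\<close>

type_synonym ('a, 'n) tvec = "('a, 'n) chart \<Rightarrow> (complex, 'n) vec"

type_synonym ('a, 'n) vfield = "'a \<Rightarrow> ('a, 'n) tvec"

definition coord_change ::
    "('a, 'n::finite) chart \<Rightarrow> ('a, 'n) chart \<Rightarrow> 'a \<Rightarrow> complex^'n \<Rightarrow> complex^'n" where
  "coord_change c d p = frechet_derivative (snd d \<circ> chart_inv c) (at (snd c p))"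

definition tangent_space :: "('a, 'n::finite) chart set \<Rightarrow> 'a \<Rightarrow> ('a, 'n) tvec set" where
  "tangent_space A p = {v.
     (\<forall>c\<in>charts_at A p. \<forall>d\<in>charts_at A p. v d = coord_change c d p (v c)) \<and>
     (\<forall>c. c \<notin> charts_at A p \<longrightarrow> v c = 0)}"

text \<open>The coordinate vector \<open>\<partial>/\<partial>z\<^sub>i\<close> of the chart \<open>c\<close> at \<open>p\<close>.\<close>

definition coord_vec ::
    "('a, 'n::finite) chart set \<Rightarrow> ('a, 'n) chart \<Rightarrow> 'n \<Rightarrow> 'a \<Rightarrow> ('a, 'n) tvec" where
  "coord_vec A c i p = (\<lambda>d. if d \<in> charts_at A p then coord_change c d p (axis i 1) else 0)"

definition vf_coords ::
    "('a, 'n::finite) vfield \<Rightarrow> ('a, 'n) chart \<Rightarrow> complex^'n \<Rightarrow> complex^'n" where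
  "vf_coords V c z = V (chart_inv c z) c"

definition vector_fields :: "('a, 'n::finite) chart set \<Rightarrow> ('a, 'n) vfield set" where
  "vector_fields A = {V. (\<forall>p. V p \<in> tangent_space A p) \<and>
     (\<forall>c\<in>A. holo_map_on (vf_coords V c) (chart_image c))}"

text \<open>In coordinates the commutator \<open>VW - WV\<close> of derivations has components
  \<open>DW(V) - DV(W)\<close>.\<close>

definition lie_bracket ::
    "('a, 'n::finite) chart set \<Rightarrow> ('a, 'n) vfield \<Rightarrow> ('a, 'n) vfield \<Rightarrow> ('a, 'n) vfield" where
  "lie_bracket A V W p c = (if c \<in> charts_at A p
     then frechet_derivative (vf_coords W c) (at (snd c p)) (V p c)
        - frechet_derivative (vf_coords V c) (at (snd c p)) (W p c)
     else 0)"

inductive_set lie_generated ::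
    "('a, 'n::finite) chart set \<Rightarrow> ('a, 'n) vfield set \<Rightarrow> ('a, 'n) vfield set"
  for A :: "('a, 'n) chart set" and S :: "('a, 'n) vfield set" where
  gen: "V \<in> S \<Longrightarrow> V \<in> lie_generated A S"
| zero: "(\<lambda>p c. 0) \<in> lie_generated A S"
| add: "V \<in> lie_generated A S \<Longrightarrow> W \<in> lie_generated A S
    \<Longrightarrow> (\<lambda>p c. V p c + W p c) \<in> lie_generated A S"
| scale: "V \<in> lie_generated A S \<Longrightarrow> (\<lambda>p c. k *s V p c) \<in> lie_generated A S"
| bracket: "V \<in> lie_generated A S \<Longrightarrow> W \<in> lie_generated A S
    \<Longrightarrow> lie_bracket A V W \<in> lie_generated A S"

text \<open>Integral curves with complex time. Continuity is required separately because the coordinate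
  condition does not see where \<open>\<gamma>\<close> goes once it leaves the domain of the chart.\<close>

definition integral_curve ::
    "'a topology \<Rightarrow> ('a, 'n::finite) chart set \<Rightarrow> ('a, 'n) vfield \<Rightarrow> (complex \<Rightarrow> 'a) \<Rightarrow> bool" where
  "integral_curve X A V \<gamma> \<longleftrightarrow> continuous_map euclidean X \<gamma> \<and>
     (\<forall>t. \<forall>c\<in>charts_at A (\<gamma> t).
        ((\<lambda>s. snd c (\<gamma> s)) has_derivative (\<lambda>h. h *s V (\<gamma> t) c)) (at t))"

definition complete_vf ::
    "'a topology \<Rightarrow> ('a, 'n::finite) chart set \<Rightarrow> ('a, 'n) vfield \<Rightarrow> bool" where
  "complete_vf X A V \<longleftrightarrow> (\<forall>p\<in>topspace X. \<exists>\<gamma>. \<gamma> 0 = p \<and> integral_curve X A V \<gamma>)"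

text \<open>Uniform convergence on compacts. Every compact subset of a manifold is a finite union of
  compact sets contained in chart domains, so it is generated by uniform closeness of the
  coordinates on such sets.\<close>

definition vf_topology ::
    "'a topology \<Rightarrow> ('a, 'n::finite) chart set \<Rightarrow> ('a, 'n) vfield topology" where
  "vf_topology X A = topology_generated_by (insert (vector_fields A)
     {{W \<in> vector_fields A. \<forall>p\<in>K. norm (W p c - V p c) < e} | V c K e.
        V \<in> vector_fields A \<and> c \<in> A \<and> compactin X K \<and> K \<subseteq> fst c \<and> e > 0})"


section \<open>Differential forms\<close>

type_synonym ('a, 'n) form1 = "'a \<Rightarrow> ('a, 'n) tvec \<Rightarrow> complex"

type_synonym ('a, 'n) form2 = "'a \<Rightarrow> ('a, 'n) tvec \<Rightarrow> ('a, 'n) tvec \<Rightarrow> complex"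

definition linear_on_tangent ::
    "('a, 'n::finite) chart set \<Rightarrow> 'a \<Rightarrow> (('a, 'n) tvec \<Rightarrow> complex) \<Rightarrow> bool" where
  "linear_on_tangent A p l \<longleftrightarrow>
     (\<forall>v\<in>tangent_space A p. \<forall>w\<in>tangent_space A p. l (\<lambda>c. v c + w c) = l v + l w) \<and>
     (\<forall>v\<in>tangent_space A p. \<forall>k. l (\<lambda>c. k *s v c) = k * l v)"

definition form1_coeff ::
    "('a, 'n::finite) chart set \<Rightarrow> ('a, 'n) form1 \<Rightarrow> ('a, 'n) chart \<Rightarrow> 'n \<Rightarrow> complex^'n \<Rightarrow> complex" where
  "form1_coeff A \<alpha> c i z = (let p = chart_inv c z in \<alpha> p (coord_vec A c i p))"

definition form2_coeff ::
    "('a, 'n::finite) chart set \<Rightarrow> ('a, 'n) form2 \<Rightarrow> ('a, 'n) chart \<Rightarrow> 'n \<Rightarrow> 'n \<Rightarrow> complex^'n \<Rightarrow> complex"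
  where
  "form2_coeff A \<omega> c i j z =
     (let p = chart_inv c z in \<omega> p (coord_vec A c i p) (coord_vec A c j p))"

definition holo_1forms ::
    "'a topology \<Rightarrow> ('a, 'n::finite) chart set \<Rightarrow> ('a, 'n) form1 set" where
  "holo_1forms X A = {\<alpha>.
     (\<forall>p\<in>topspace X. linear_on_tangent A p (\<alpha> p)) \<and>
     (\<forall>p v. p \<notin> topspace X \<or> v \<notin> tangent_space A p \<longrightarrow> \<alpha> p v = 0) \<and>
     (\<forall>c\<in>A. \<forall>i. holo_on (form1_coeff A \<alpha> c i) (chart_image c))}"

definition closed_1form :: "('a, 'n::finite) chart set \<Rightarrow> ('a, 'n) form1 \<Rightarrow> bool" where
  "closed_1form A \<alpha> \<longleftrightarrow> (\<forall>c\<in>A. \<forall>z\<in>chart_image c. \<forall>i j.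
     partial i (form1_coeff A \<alpha> c j) z = partial j (form1_coeff A \<alpha> c i) z)"

definition holo_2forms ::
    "'a topology \<Rightarrow> ('a, 'n::finite) chart set \<Rightarrow> ('a, 'n) form2 set" where
  "holo_2forms X A = {\<omega>.
     (\<forall>p\<in>topspace X. \<forall>v\<in>tangent_space A p.
        linear_on_tangent A p (\<omega> p v) \<and> linear_on_tangent A p (\<lambda>w. \<omega> p w v) \<and> \<omega> p v v = 0) \<and>
     (\<forall>p v w. p \<notin> topspace X \<or> v \<notin> tangent_space A p \<or> w \<notin> tangent_space A p
        \<longrightarrow> \<omega> p v w = 0) \<and>
     (\<forall>c\<in>A. \<forall>i j. holo_on (form2_coeff A \<omega> c i j) (chart_image c))}"

definition closed_2form :: "('a, 'n::finite) chart set \<Rightarrow> ('a, 'n) form2 \<Rightarrow> bool" where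
  "closed_2form A \<omega> \<longleftrightarrow> (\<forall>c\<in>A. \<forall>z\<in>chart_image c. \<forall>i j k.
     partial i (form2_coeff A \<omega> c j k) z + partial j (form2_coeff A \<omega> c k i) z
       + partial k (form2_coeff A \<omega> c i j) z = 0)"

definition nondegenerate_2form ::
    "'a topology \<Rightarrow> ('a, 'n::finite) chart set \<Rightarrow> ('a, 'n) form2 \<Rightarrow> bool" where
  "nondegenerate_2form X A \<omega> \<longleftrightarrow> (\<forall>p\<in>topspace X. \<forall>v\<in>tangent_space A p.
     (\<forall>w\<in>tangent_space A p. \<omega> p v w = 0) \<longrightarrow> v = (\<lambda>c. 0))"

definition holo_symplectic_form ::
    "'a topology \<Rightarrow> ('a, 'n::finite) chart set \<Rightarrow> ('a, 'n) form2 \<Rightarrow> bool" where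
  "holo_symplectic_form X A \<omega> \<longleftrightarrow>
     \<omega> \<in> holo_2forms X A \<and> closed_2form A \<omega> \<and> nondegenerate_2form X A \<omega>"

text \<open>The value of \<open>df\<close> on a tangent vector, computed in any chart around the point.\<close>

definition diff ::
    "'a topology \<Rightarrow> ('a, 'n::finite) chart set \<Rightarrow> ('a \<Rightarrow> complex) \<Rightarrow> ('a, 'n) form1" where
  "diff X A f p v = (if p \<in> topspace X \<and> v \<in> tangent_space A p
     then let c = (SOME c. c \<in> charts_at A p)
          in frechet_derivative (f \<circ> chart_inv c) (at (snd c p)) (v c)
     else 0)"

definition flat :: "('a, 'n::finite) form2 \<Rightarrow> ('a, 'n) vfield \<Rightarrow> ('a, 'n) form1" where
  "flat \<omega> V p w = \<omega> p (V p) w"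


section \<open>First holomorphic de Rham cohomology\<close>

definition closed_1forms ::
    "'a topology \<Rightarrow> ('a, 'n::finite) chart set \<Rightarrow> ('a, 'n) form1 set" where
  "closed_1forms X A = {\<alpha> \<in> holo_1forms X A. closed_1form A \<alpha>}"

definition dR_rel ::
    "'a topology \<Rightarrow> ('a, 'n::finite) chart set \<Rightarrow> (('a, 'n) form1 \<times> ('a, 'n) form1) set" where
  "dR_rel X A = {(\<alpha>, \<beta>). \<alpha> \<in> closed_1forms X A \<and> \<beta> \<in> closed_1forms X A \<and>
     (\<exists>f\<in>holo_functions A. (\<lambda>p v. \<alpha> p v - \<beta> p v) = diff X A f)}"

definition H1_dR ::
    "'a topology \<Rightarrow> ('a, 'n::finite) chart set \<Rightarrow> ('a, 'n) form1 set set" where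
  "H1_dR X A = closed_1forms X A // dR_rel X A"

definition dR_class ::
    "'a topology \<Rightarrow> ('a, 'n::finite) chart set \<Rightarrow> ('a, 'n) form1 \<Rightarrow> ('a, 'n) form1 set" where
  "dR_class X A \<alpha> = dR_rel X A `` {\<alpha>}"

text \<open>The vector space structure of the quotient: a finite linear combination of classes is the
  class of the same combination of representatives, for all choices \<open>a\<close> of representatives.\<close>

definition dR_lincomb ::
    "'a topology \<Rightarrow> ('a, 'n::finite) chart set \<Rightarrow> 'j set \<Rightarrow> ('j \<Rightarrow> complex)
      \<Rightarrow> ('j \<Rightarrow> ('a, 'n) form1 set) \<Rightarrow> ('a, 'n) form1 set" where
  "dR_lincomb X A F k x =
     (\<Union>a\<in>{a. \<forall>j\<in>F. a j \<in> x j}. dR_class X A (\<lambda>p v. \<Sum>j\<in>F. k j * a j p v))"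

definition dR_basis ::
    "'a topology \<Rightarrow> ('a, 'n::finite) chart set \<Rightarrow> 'j set \<Rightarrow> ('j \<Rightarrow> ('a, 'n) form1 set) \<Rightarrow> bool" where
  "dR_basis X A J x \<longleftrightarrow>
     (\<forall>j\<in>J. x j \<in> H1_dR X A) \<and>
     (\<forall>F k. finite F \<and> F \<subseteq> J \<and> dR_lincomb X A F k x = dR_class X A (\<lambda>p v. 0)
        \<longrightarrow> (\<forall>j\<in>F. k j = 0)) \<and>
     (\<forall>h\<in>H1_dR X A. \<exists>F k. finite F \<and> F \<subseteq> J \<and> h = dR_lincomb X A F k x)"


section \<open>Symplectic and Hamiltonian vector fields, density properties\<close>

definition SVF ::
    "('a, 'n::finite) chart set \<Rightarrow> ('a, 'n) form2 \<Rightarrow> ('a, 'n) vfield set" where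
  "SVF A \<omega> = {V \<in> vector_fields A. closed_1form A (flat \<omega> V)}"

definition HVF ::
    "'a topology \<Rightarrow> ('a, 'n::finite) chart set \<Rightarrow> ('a, 'n) form2 \<Rightarrow> ('a, 'n) vfield set" where
  "HVF X A \<omega> = {V \<in> vector_fields A. \<exists>f\<in>holo_functions A. flat \<omega> V = diff X A f}"

definition hamiltonian_density_property ::
    "'a topology \<Rightarrow> ('a, 'n::finite) chart set \<Rightarrow> ('a, 'n) form2 \<Rightarrow> bool" where
  "hamiltonian_density_property X A \<omega> \<longleftrightarrow>
     subtopology (vf_topology X A) (HVF X A \<omega>) closure_of
       lie_generated A {V \<in> HVF X A \<omega>. complete_vf X A V} = HVF X A \<omega>"

definition symplectic_density_property ::
    "'a topology \<Rightarrow> ('a, 'n::finite) chart set \<Rightarrow> ('a, 'n) form2 \<Rightarrow> bool" where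
  "symplectic_density_property X A \<omega> \<longleftrightarrow>
     subtopology (vf_topology X A) (SVF A \<omega>) closure_of
       lie_generated A {V \<in> SVF A \<omega>. complete_vf X A V} = SVF A \<omega>"

end

theory Submission
  imports Defs "HOL-Complex_Analysis.Cauchy_Integral_Formula"
begin

text \<open>The basis property makes every symplectic field \<open>W\<close> the sum of a Hamiltonian field \<open>H\<close> and a
  finite linear combination \<open>S\<close> of the complete fields \<open>V j\<close>: the closed form \<open>flat \<omega> W\<close> is
  cohomologous to a combination of the \<open>flat \<omega> (V j)\<close>, and \<open>flat \<omega>\<close> is linear
  (\<open>symplectic_decomposition\<close>). By the Hamiltonian density property, \<open>H\<close> is a limit of fields \<open>Y\<close> in
  the Lie algebra generated by the complete Hamiltonian fields. As translation by \<open>S\<close> is continuous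
  (\<open>continuous_map_vf_translation\<close>), the fields \<open>Y + S\<close> approximate \<open>W\<close>. They lie in the Lie algebra
  generated by the complete symplectic fields because Hamiltonian fields are symplectic
  (\<open>HVF_subset_SVF\<close>) and \<open>S\<close> is a linear combination of complete symplectic fields.

  That Hamiltonian fields are symplectic means that \<open>df\<close> is closed, that is, that the second partial
  derivatives of a holomorphic function commute. Holomorphy is only assumed as complex
  differentiability, so this needs Cauchy's formula: it expresses a partial derivative as an integral
  with parameter over a circle in one coordinate direction, which shows first that partial
  derivatives are continuous (\<open>continuous_on_partial\<close>), then that they are holomorphic
  (\<open>holo_on_partial\<close>) and that they commute (\<open>partial_commute\<close>).\<close>

section \<open>Partial derivatives of holomorphic functions\<close>

lemma vec_eq_sum_axis: "(u::complex^'n) = (\<Sum>i\<in>UNIV. (u $ i) *s axis i 1)"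
  by (simp add: vec_eq_iff axis_def if_distrib cong: if_cong)

lemma scaleR_vector_scalar_mult: "((r *\<^sub>R k) *s v) = r *\<^sub>R (k *s (v::complex^'n))"
  by (simp add: vec_eq_iff)

lemma bounded_linear_scale_left: "bounded_linear (\<lambda>k. k *s (v::complex^'n))"
  unfolding linear_conv_bounded_linear[symmetric]
  by (rule linearI) (simp_all add: scaleR_vector_scalar_mult vector_sadd_rdistrib)

lemma norm_scale_axis: "norm (k *s axis i (1::complex) :: complex^'n) = norm k"
proof -
  have "norm ((k *s axis i (1::complex) :: complex^'n) $ j) = (if j = i then norm k else 0)" for j
    by (simp add: axis_def)
  then show ?thesis unfolding norm_vec_def L2_set_def
    by (simp add: if_distrib[of "\<lambda>x. x ^ 2"] cong: if_cong)
qed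

lemma holo_onI:
  assumes "\<And>z. z \<in> S \<Longrightarrow> (f has_derivative D z) (at z)"
    and "\<And>z k u. z \<in> S \<Longrightarrow> D z (k *s u) = k * D z u"
  shows "holo_on f S"
  using assms unfolding holo_on_def by blast

lemma holo_on_derivative:
  assumes "holo_on f S" "z \<in> S"
  shows "(f has_derivative frechet_derivative f (at z)) (at z)"
    and "frechet_derivative f (at z) (k *s u) = k * frechet_derivative f (at z) u"
proof -
  obtain f' where f': "(f has_derivative f') (at z)" "\<And>k u. f' (k *s u) = k * f' u"
    using assms unfolding holo_on_def by blast
  have "f' = frechet_derivative f (at z)" by (rule frechet_derivative_at[OF f'(1)])
  then show "(f has_derivative frechet_derivative f (at z)) (at z)"
    and "frechet_derivative f (at z) (k *s u) = k * frechet_derivative f (at z) u"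
    using f' by auto
qed

lemma frechet_derivative_partial:
  assumes "holo_on f S" "z \<in> S"
  shows "frechet_derivative f (at z) u = (\<Sum>i\<in>UNIV. u $ i * partial i f z)"
proof -
  interpret bounded_linear "frechet_derivative f (at z)"
    by (rule has_derivative_bounded_linear[OF holo_on_derivative(1)[OF assms]])
  have "frechet_derivative f (at z) u =
      frechet_derivative f (at z) (\<Sum>i\<in>UNIV. (u $ i) *s axis i 1)"
    using vec_eq_sum_axis[of u] by simp
  then show ?thesis
    by (simp add: sum holo_on_derivative(2)[OF assms] partial_def)
qed

lemma holo_on_continuous_on:
  assumes "holo_on f S" shows "continuous_on S f"
  by (meson assms continuous_at_imp_continuous_on has_derivative_continuous holo_on_derivative(1))

lemma holo_on_const: "holo_on (\<lambda>z. k) S"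
  by (rule holo_onI[where D="\<lambda>z u. 0"]) auto

lemma holo_on_add:
  assumes "holo_on f S" "holo_on g S" shows "holo_on (\<lambda>z. f z + g z) S"
  by (rule holo_onI, rule has_derivative_add[OF holo_on_derivative(1)[OF assms(1)]
        holo_on_derivative(1)[OF assms(2)]])
     (simp_all add: algebra_simps holo_on_derivative(2)[OF assms(1)]
        holo_on_derivative(2)[OF assms(2)])

lemma holo_on_mult:
  assumes "holo_on f S" "holo_on g S" shows "holo_on (\<lambda>z. f z * g z) S"
  by (rule holo_onI, rule has_derivative_mult[OF holo_on_derivative(1)[OF assms(1)]
        holo_on_derivative(1)[OF assms(2)]])
     (simp_all add: algebra_simps holo_on_derivative(2)[OF assms(1)]
        holo_on_derivative(2)[OF assms(2)])

lemma holo_on_sum: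
  assumes "finite F" "\<And>j. j \<in> F \<Longrightarrow> holo_on (f j) S" shows "holo_on (\<lambda>z. \<Sum>j\<in>F. f j z) S"
  using assms by (induction F) (auto intro: holo_on_const holo_on_add)

lemma has_derivative_cong_open:
  assumes "(f has_derivative D) (at z)" "open S" "z \<in> S" "\<And>w. w \<in> S \<Longrightarrow> f w = g w"
  shows "(g has_derivative D) (at z)"
  using has_derivative_transform_within_open[OF assms] .

lemma frechet_derivative_cong_open:
  assumes "open S" "z \<in> S" "\<And>w. w \<in> S \<Longrightarrow> f w = g w"
  shows "frechet_derivative f (at z) = frechet_derivative g (at z)"
proof -
  have "(f has_derivative D) (at z) \<longleftrightarrow> (g has_derivative D) (at z)" for D
    using has_derivative_cong_open[of f D z S g] has_derivative_cong_open[of g D z S f] assms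
    by auto
  then show ?thesis unfolding frechet_derivative_def by simp
qed

lemma partial_cong_open:
  assumes "open S" "z \<in> S" "\<And>w. w \<in> S \<Longrightarrow> f w = g w"
  shows "partial i f z = partial i g z"
  unfolding partial_def using frechet_derivative_cong_open[OF assms] by simp

lemma holo_on_cong_open:
  assumes "open S" "\<And>w. w \<in> S \<Longrightarrow> f w = g w" "holo_on f S"
  shows "holo_on g S"
  by (rule holo_onI, rule has_derivative_cong_open[OF holo_on_derivative(1)[OF assms(3)] assms(1)])
     (simp_all add: assms(2) holo_on_derivative(2)[OF assms(3)])

lemma partial_add:
  assumes "holo_on f S" "holo_on g S" "z \<in> S"
  shows "partial i (\<lambda>z. f z + g z) z = partial i f z + partial i g z"
  using frechet_derivative_at[OF has_derivative_add[OF holo_on_derivative(1)[OF assms(1,3)]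
        holo_on_derivative(1)[OF assms(2,3)]]]
  unfolding partial_def by metis

lemma partial_cmult:
  assumes "holo_on f S" "z \<in> S"
  shows "partial i (\<lambda>z. k * f z) z = k * partial i f z"
  using frechet_derivative_at[OF has_derivative_mult_right[OF holo_on_derivative(1)[OF assms(1,2)]]]
  unfolding partial_def by metis

text \<open>The circle of radius \<open>r\<close> parametrized over \<open>[0, 1]\<close>. A plain interval integral is preferred to a
  contour integral because the theorems on parameter integrals apply to it directly.\<close>

definition circ :: "real \<Rightarrow> real \<Rightarrow> complex" where
  "circ r t = of_real r * exp (2 * of_real pi * \<i> * of_real t)"

lemma norm_circ: "norm (circ r t) = \<bar>r\<bar>"
  by (simp add: circ_def norm_mult)

lemma circ_nonzero: "r \<noteq> 0 \<Longrightarrow> circ r t \<noteq> 0"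
  by (simp add: circ_def)

lemma continuous_on_circ [continuous_intros]:
  "continuous_on S f \<Longrightarrow> continuous_on S (\<lambda>x. circ r (f x))"
  unfolding circ_def by (intro continuous_intros)

lemma continuous_on_scale_left [continuous_intros]:
  "continuous_on S f \<Longrightarrow> continuous_on S (\<lambda>x. f x *s (v::complex^'n))"
  by (rule bounded_linear.continuous_on[OF bounded_linear_scale_left])

text \<open>Cauchy's formula for the derivative at the centre of a circle, applied to the function
  \<open>\<zeta> \<mapsto> f (z + \<zeta> e\<^sub>i)\<close> of one variable. In \<open>\<integral> g(u) / u^2 du\<close> the factor \<open>du = 2 \<pi> \<i> u dt\<close> cancels
  one power of \<open>u\<close> and the factor \<open>1 / (2 \<pi> \<i>)\<close> in front.\<close>

lemma partial_eq_circle_integral: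
  fixes f :: "complex^'n \<Rightarrow> complex"
  assumes f: "holo_on f S" and r: "0 < r" and sub: "cball z r \<subseteq> S"
  shows "partial i f z = integral {0..1} (\<lambda>t. f (z + circ r t *s axis i 1) / circ r t)"
proof -
  define g where "g = (\<lambda>\<zeta>. f (z + \<zeta> *s axis i 1))"
  have inS: "z + \<zeta> *s axis i 1 \<in> S" if "norm \<zeta> \<le> r" for \<zeta>
    using that sub by (auto simp: subset_iff dist_norm norm_scale_axis)
  have der: "(g has_field_derivative partial i f (z + \<zeta> *s axis i 1)) (at \<zeta>)" if "norm \<zeta> \<le> r" for \<zeta>
  proof -
    let ?w = "z + \<zeta> *s axis i 1"
    have "((\<lambda>\<zeta>. z + \<zeta> *s axis i 1) has_derivative (\<lambda>h. h *s axis i 1)) (at \<zeta>)"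
      by (auto intro!: derivative_eq_intros
          bounded_linear.has_derivative[OF bounded_linear_scale_left])
    from has_derivative_compose[OF this holo_on_derivative(1)[OF f inS[OF that]]]
    show ?thesis
      unfolding has_field_derivative_def g_def
      by (rule has_derivative_eq_rhs)
         (simp add: fun_eq_iff holo_on_derivative(2)[OF f inS[OF that]] partial_def)
  qed
  have c: "continuous_on (cball 0 r) g"
    by (rule DERIV_continuous_on[where D="\<lambda>\<zeta>. partial i f (z + \<zeta> *s axis i 1)"])
       (auto intro: der DERIV_subset)
  have h: "g holomorphic_on ball 0 r"
    unfolding holomorphic_on_def field_differentiable_def
    by (auto intro!: exI der[THEN DERIV_subset])
  have "(g has_field_derivative (1 / (2 * of_real pi * \<i>) *
      contour_integral (circlepath 0 r) (\<lambda>u. g u / (u - 0)^2))) (at 0)"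
    by (rule Cauchy_derivative_integral_circlepath(2)[OF c h]) (use r in simp)
  from DERIV_unique[OF der[of 0] this] r
  have "partial i f z = 1 / (2 * of_real pi * \<i>) *
      contour_integral (circlepath 0 r) (\<lambda>u. g u / u^2)" by simp
  also have "contour_integral (circlepath 0 r) (\<lambda>u. g u / u^2)
      = integral {0..1} (\<lambda>t. (2 * of_real pi * \<i>) * (g (circ r t) / circ r t))"
    unfolding contour_integral_integral vector_derivative_circlepath
    by (intro integral_cong)
       (use r in \<open>simp add: circlepath circ_def power2_eq_square field_simps\<close>)
  also have "\<dots> = (2 * of_real pi * \<i>) * integral {0..1} (\<lambda>t. g (circ r t) / circ r t)"
    by (rule integral_mult_right)
  finally show ?thesis by (simp add: g_def)
qed

lemma circ_in_ball:
  fixes z :: "complex^'n"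
  assumes "z \<in> ball z0 r" "0 < r"
  shows "z + circ r t *s axis i 1 \<in> ball z0 (2 * r)"
proof -
  have "dist z0 (z + circ r t *s axis i 1) \<le> dist z0 z + norm (circ r t *s axis i (1::complex) :: complex^'n)"
    using dist_triangle[of z0 "z + circ r t *s axis i 1" z] by (simp add: dist_norm)
  then show ?thesis using assms by (simp add: norm_scale_axis norm_circ)
qed

text \<open>With a margin of twice the radius, one fixed circle serves for all \<open>z\<close> in a neighbourhood of
  \<open>z0\<close>; this makes the formula an integral with parameter \<open>z\<close>.\<close>

lemma partial_eq_circle_integral_near:
  fixes f :: "complex^'n \<Rightarrow> complex"
  assumes f: "holo_on f S" and r: "0 < r" and sub: "ball z0 (2 * r) \<subseteq> S" and z: "z \<in> ball z0 r"
  shows "partial i f z = integral (cbox 0 1) (\<lambda>t. f (z + circ r t *s axis i 1) / circ r t)"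
proof -
  have "dist z0 w < 2 * r" if "dist z w \<le> r" for w
    using that z dist_triangle[of z0 w z] by simp
  then have "cball z r \<subseteq> S" using sub by auto
  from partial_eq_circle_integral[OF f r this] show ?thesis by simp
qed

lemma obtain_double_ball:
  assumes "open S" "z \<in> S"
  obtains r where "0 < r" "ball z (2 * r) \<subseteq> S"
proof -
  obtain e where "e > 0" "ball z e \<subseteq> S" using assms openE by blast
  then show ?thesis using that[of "e/2"] by simp
qed

text \<open>Mere complex differentiability gives no continuity of the derivative directly, but Cauchy's
  formula involves only the values of \<open>f\<close>, which are continuous.\<close>

lemma continuous_on_partial:
  fixes f :: "complex^'n \<Rightarrow> complex"
  assumes f: "holo_on f S" and S: "open S"
  shows "continuous_on S (partial i f)"
proof (rule continuous_at_imp_continuous_on, rule ballI)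
  fix z0 assume "z0 \<in> S"
  then obtain r where r: "0 < r" "ball z0 (2 * r) \<subseteq> S" using obtain_double_ball[OF S] by blast
  have "continuous_on (ball z0 r \<times> cbox 0 1)
      (\<lambda>(z, t). f (z + circ r t *s axis i 1) / circ r t)"
    unfolding split_beta
    by (intro continuous_intros continuous_on_compose2[OF holo_on_continuous_on[OF f]])
       (use subsetD[OF r(2) circ_in_ball[OF _ r(1)]] r circ_nonzero in \<open>auto simp del: mem_ball\<close>)
  then have "continuous_on (ball z0 r)
      (\<lambda>z. integral (cbox 0 1) (\<lambda>t. f (z + circ r t *s axis i 1) / circ r t))"
    by (rule integral_continuous_on_param)
  then have "continuous_on (ball z0 r) (partial i f)"
    by (rule continuous_on_eq) (simp only: partial_eq_circle_integral_near[OF f r])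
  then show "continuous (at z0) (partial i f)"
    using r by (simp add: continuous_on_eq_continuous_at)
qed

text \<open>Since the partial derivatives of \<open>f\<close> are continuous, Leibniz' rule allows differentiation under
  the integral sign in Cauchy's formula for \<open>partial j f\<close>. The resulting derivative is complex
  linear because the derivatives of \<open>f\<close> are, and in direction \<open>e\<^sub>i\<close> it is the Cauchy integral of
  \<open>partial i f\<close> along the \<open>j\<close>-th coordinate direction.\<close>

lemma partial_has_derivative:
  fixes f :: "complex^'n \<Rightarrow> complex"
  assumes f: "holo_on f S" and S: "open S" and z0: "z0 \<in> S"
  shows "\<exists>D. (partial j f has_derivative D) (at z0) \<and> (\<forall>k u. D (k *s u) = k * D u) \<and>
    (\<forall>i r. 0 < r \<longrightarrow> ball z0 (2 * r) \<subseteq> S \<longrightarrow> D (axis i 1) =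
      integral (cbox 0 1) (\<lambda>t. partial i f (z0 + circ r t *s axis j 1) / circ r t))"
proof -
  have main: "\<exists>D. (partial j f has_derivative D) (at z0) \<and> (\<forall>u. D u =
       integral (cbox 0 1) (\<lambda>t. frechet_derivative f (at (z0 + circ r t *s axis j 1)) u / circ r t))"
    if r: "0 < r" "ball z0 (2 * r) \<subseteq> S" for r
  proof -
    let ?p = "\<lambda>z t. z + circ r t *s axis j 1"
    define L where "L z t = Blinfun (\<lambda>u. frechet_derivative f (at (?p z t)) u / circ r t)" for z t
    have inS: "?p z t \<in> S" if "z \<in> ball z0 r" for z t
      using circ_in_ball[OF that r(1)] r(2) by blast
    have L: "blinfun_apply (L z t) = (\<lambda>u. frechet_derivative f (at (?p z t)) u / circ r t)"
      if "z \<in> ball z0 r" for z t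
      unfolding L_def
      by (rule bounded_linear_Blinfun_apply, rule bounded_linear_divide[THEN bounded_linear_compose])
         (rule has_derivative_bounded_linear[OF holo_on_derivative(1)[OF f inS[OF that]]])
    have cont: "continuous_on (ball z0 r \<times> cbox 0 1) (\<lambda>(z, t). L z t)"
    proof (rule continuous_on_blinfun_componentwise)
      fix b :: "complex^'n"
      have "continuous_on (ball z0 r \<times> cbox 0 1)
          (\<lambda>x. (\<Sum>i\<in>UNIV. b $ i * partial i f (?p (fst x) (snd x))) / circ r (snd x))"
        by (intro continuous_intros continuous_on_compose2[OF continuous_on_partial[OF f S]])
           (use inS r circ_nonzero in \<open>auto simp del: mem_ball\<close>)
      then show "continuous_on (ball z0 r \<times> cbox 0 1) (\<lambda>x. blinfun_apply (case x of (z, t) \<Rightarrow> L z t) b)"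
        by (rule continuous_on_eq)
           (auto simp: L frechet_derivative_partial[OF f inS] simp del: mem_ball)
    qed
    have "((\<lambda>z. integral (cbox 0 1) (\<lambda>t. f (?p z t) / circ r t)) has_derivative
        integral (cbox 0 1) (L z0)) (at z0 within ball z0 r)"
    proof (rule leibniz_rule[OF _ _ cont])
      fix z t assume z: "z \<in> ball z0 r"
      have "((\<lambda>z. ?p z t) has_derivative (\<lambda>u. u)) (at z)"
        by (auto intro!: derivative_eq_intros)
      from has_derivative_compose[OF this holo_on_derivative(1)[OF f inS[OF z]]]
      have "((\<lambda>z. f (?p z t) / circ r t) has_derivative blinfun_apply (L z t)) (at z)"
        unfolding L[OF z] by (rule bounded_linear.has_derivative[OF bounded_linear_divide])
      then show "((\<lambda>z. f (?p z t) / circ r t) has_derivative blinfun_apply (L z t))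
          (at z within ball z0 r)"
        by (rule has_derivative_at_withinI)
    next
      fix z assume z: "z \<in> ball z0 r"
      show "(\<lambda>t. f (?p z t) / circ r t) integrable_on cbox 0 1"
        by (rule integrable_continuous)
           (intro continuous_intros continuous_on_compose2[OF holo_on_continuous_on[OF f]];
            use inS[OF z] r circ_nonzero in \<open>auto simp del: mem_ball\<close>)
    qed (use r in auto)
    then have "((\<lambda>z. integral (cbox 0 1) (\<lambda>t. f (?p z t) / circ r t)) has_derivative
        integral (cbox 0 1) (L z0)) (at z0)"
      using r by (simp add: at_within_open[of z0 "ball z0 r"])
    then have "(partial j f has_derivative integral (cbox 0 1) (L z0)) (at z0)"
      by (rule has_derivative_cong_open[of _ _ _ "ball z0 r"])
         (use r partial_eq_circle_integral_near[OF f r] in auto)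
    moreover have "integral (cbox 0 1) (L z0) u =
        integral (cbox 0 1) (\<lambda>t. frechet_derivative f (at (?p z0 t)) u / circ r t)" for u
    proof -
      have z0: "z0 \<in> ball z0 r" using r by simp
      have "continuous_on (cbox 0 1) (L z0)"
        using continuous_on_compose2[OF cont, of "cbox 0 1 :: real set" "\<lambda>t. (z0, t)"] z0
          continuous_on_Pair[OF continuous_on_const continuous_on_id, of "cbox 0 1 :: real set" z0]
        by (simp add: image_subset_iff)
      then have "L z0 integrable_on cbox 0 1" by (rule integrable_continuous)
      from blinfun_apply_integral[OF this] show ?thesis by (simp add: L[OF z0])
    qed
    ultimately show ?thesis by blast
  qed
  \<comment> \<open>Linearity is read off from one admissible radius; the formula then holds for every admissible
    radius because derivatives are unique.\<close>
  obtain r0 where r0: "0 < r0" "ball z0 (2 * r0) \<subseteq> S" using obtain_double_ball[OF S z0] by blast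
  obtain D where D: "(partial j f has_derivative D) (at z0)" and D0: "\<And>u. D u =
       integral (cbox 0 1) (\<lambda>t. frechet_derivative f (at (z0 + circ r0 t *s axis j 1)) u / circ r0 t)"
    using main[OF r0] by blast
  show ?thesis
  proof (intro exI[of _ D] conjI allI impI D)
    fix k u
    have "z0 + circ r0 t *s axis j 1 \<in> S" for t
      using circ_in_ball[of z0 z0 r0] r0 by auto
    note inS = this
    show "D (k *s u) = k * D u"
      unfolding D0 integral_mult_right[symmetric]
      by (simp add: holo_on_derivative(2)[OF f inS])
  next
    fix i r assume r: "0 < r" "ball z0 (2 * r) \<subseteq> S"
    from main[OF r] obtain D' where D': "(partial j f has_derivative D') (at z0)" and e: "\<And>u. D' u =
       integral (cbox 0 1) (\<lambda>t. frechet_derivative f (at (z0 + circ r t *s axis j 1)) u / circ r t)"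
      by blast
    have "D = D'" by (rule has_derivative_unique[OF D D'])
    then show "D (axis i 1) =
      integral (cbox 0 1) (\<lambda>t. partial i f (z0 + circ r t *s axis j 1) / circ r t)"
      by (simp add: e partial_def)
  qed
qed

lemma holo_on_partial:
  assumes f: "holo_on f S" and S: "open S"
  shows "holo_on (partial j f) S"
  unfolding holo_on_def
proof
  fix z assume "z \<in> S"
  then show "\<exists>D. (partial j f has_derivative D) (at z) \<and> (\<forall>k u. D (k *s u) = k * D u)"
    using partial_has_derivative[OF f S, of z j] by blast
qed

text \<open>The \<open>i\<close>-th partial derivative of \<open>partial j f\<close> is the Cauchy integral of \<open>partial i f\<close> along the
  \<open>j\<close>-th direction, and this integral is \<open>partial j (partial i f)\<close> because \<open>partial i f\<close> is itself
  holomorphic.\<close>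

lemma partial_commute:
  assumes f: "holo_on f S" and S: "open S" and z: "z \<in> S"
  shows "partial i (partial j f) z = partial j (partial i f) z"
proof -
  obtain r where r: "0 < r" "ball z (2 * r) \<subseteq> S" using obtain_double_ball[OF S z] by blast
  obtain D where D: "(partial j f has_derivative D) (at z)"
    and int: "\<And>i r. \<lbrakk>0 < r; ball z (2 * r) \<subseteq> S\<rbrakk> \<Longrightarrow> D (axis i 1) =
      integral (cbox 0 1) (\<lambda>t. partial i f (z + circ r t *s axis j 1) / circ r t)"
    using partial_has_derivative[OF f S z, of j] by blast
  have "partial i (partial j f) z = D (axis i 1)"
    using frechet_derivative_at[OF D] by (simp add: partial_def)
  also have "\<dots> = partial j (partial i f) z"
    using partial_eq_circle_integral_near[OF holo_on_partial[OF f S] r, of z j i] r int[OF r] by simp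
  finally show ?thesis .
qed

section \<open>Tangent vectors and differentials in charts\<close>

lemma chart_inv_mem:
  assumes "z \<in> chart_image c" shows "chart_inv c z \<in> fst c"
  using assms unfolding chart_image_def chart_inv_def by (rule inv_into_into)

lemma chart_of_chart_inv:
  assumes "z \<in> chart_image c" shows "snd c (chart_inv c z) = z"
  using assms unfolding chart_image_def chart_inv_def by (rule f_inv_into_f)

lemma chart_image_memI: "p \<in> fst c \<Longrightarrow> snd c p \<in> chart_image c"
  unfolding chart_image_def by simp

lemma chart_mem_topspace:
  assumes "complex_manifold X A" "c \<in> A" "p \<in> fst c" shows "p \<in> topspace X"
  using assms unfolding complex_manifold_def by blast

lemma chart_exists:
  assumes "complex_manifold X A" "p \<in> topspace X" obtains c where "c \<in> charts_at A p"
  using assms unfolding complex_manifold_def charts_at_def by blast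

lemma open_chart_image:
  assumes "complex_manifold X A" "c \<in> A" shows "open (chart_image c)"
  using assms unfolding complex_manifold_def is_chart_def by blast

lemma chart_inv_of_chart:
  assumes "complex_manifold X A" "c \<in> A" "p \<in> fst c" shows "chart_inv c (snd c p) = p"
proof -
  have c: "is_chart X c" using assms unfolding complex_manifold_def by blast
  then have "fst c \<subseteq> topspace X" unfolding is_chart_def by (simp add: openin_subset)
  moreover have "inj_on (snd c) (topspace (subtopology X (fst c)))"
    using c unfolding is_chart_def by (blast intro: homeomorphic_imp_injective_map)
  ultimately have "inj_on (snd c) (fst c)" by (simp add: Int_absorb1)
  then show ?thesis unfolding chart_inv_def using assms(3) by (rule inv_into_f_f)
qed

lemma open_chart_overlap:
  assumes M: "complex_manifold X A" and "c \<in> A" "d \<in> A"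
  shows "open (snd c ` (fst c \<inter> fst d))"
proof -
  have c: "is_chart X c" and d: "is_chart X d" using assms unfolding complex_manifold_def by blast+
  have "open_map (subtopology X (fst c)) (top_of_set (chart_image c)) (snd c)"
    using c unfolding is_chart_def by (blast intro: homeomorphic_imp_open_map)
  moreover have "openin (subtopology X (fst c)) (fst c \<inter> fst d)"
    using d unfolding is_chart_def by (simp add: openin_subtopology_Int2)
  ultimately have "openin (top_of_set (chart_image c)) (snd c ` (fst c \<inter> fst d))"
    unfolding open_map_def by blast
  then show ?thesis using open_chart_image[OF M \<open>c \<in> A\<close>] by (rule openin_open_trans)
qed

lemma has_derivative_vec_componentwise:
  fixes F :: "'b::real_normed_vector \<Rightarrow> complex^'n"
  assumes "\<And>i. ((\<lambda>z. F z $ i) has_derivative (\<lambda>u. D u $ i)) (at z)"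
  shows "(F has_derivative D) (at z)"
proof (subst has_derivative_componentwise_within, rule ballI)
  fix b :: "complex^'n" assume "b \<in> Basis"
  then obtain i e where "b = axis i e" by (auto simp: Basis_vec_def)
  then show "((\<lambda>z. F z \<bullet> b) has_derivative (\<lambda>u. D u \<bullet> b)) (at z)"
    using has_derivative_inner_left[OF assms, of i e] by (simp add: inner_axis)
qed

lemma coord_change_has_derivative:
  assumes M: "complex_manifold X A" and c: "c \<in> charts_at A p" and d: "d \<in> charts_at A p"
  shows "((snd d \<circ> chart_inv c) has_derivative coord_change c d p) (at (snd c p))"
    and "coord_change c d p (k *s u) = k *s coord_change c d p u"
proof -
  let ?F = "snd d \<circ> chart_inv c" and ?z = "snd c p"
  have h: "holo_on (\<lambda>z. ?F z $ i) (snd c ` (fst c \<inter> fst d))" for i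
    using M c d unfolding complex_manifold_def charts_at_def holo_map_on_def by blast
  have z: "?z \<in> snd c ` (fst c \<inter> fst d)" using c d unfolding charts_at_def by blast
  let ?D = "\<lambda>u. \<chi> i. frechet_derivative (\<lambda>z. ?F z $ i) (at ?z) u"
  have D: "(?F has_derivative ?D) (at ?z)"
    by (rule has_derivative_vec_componentwise) (simp, rule holo_on_derivative(1)[OF h z, unfolded comp_def])
  have e: "coord_change c d p = ?D"
    unfolding coord_change_def using frechet_derivative_at[OF D] by simp
  show "(?F has_derivative coord_change c d p) (at ?z)" using D e by simp
  show "coord_change c d p (k *s u) = k *s coord_change c d p u"
    unfolding e by (simp add: vec_eq_iff holo_on_derivative(2)[OF h z, unfolded comp_def])
qed

lemma coord_change_linear:
  assumes M: "complex_manifold X A" and c: "c \<in> charts_at A p" and d: "d \<in> charts_at A p"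
  shows "linear (coord_change c d p)"
  using coord_change_has_derivative(1)[OF assms] has_derivative_linear by blast

text \<open>The chain rule for a change of charts: near \<open>snd c p\<close>, the function \<open>G\<close> read in \<open>c\<close> is \<open>G\<close> read
  in \<open>d\<close> after the coordinate change.\<close>

lemma has_derivative_change_chart:
  assumes M: "complex_manifold X A" and c: "c \<in> charts_at A p" and d: "d \<in> charts_at A p"
    and G: "((G \<circ> chart_inv d) has_derivative D) (at (snd d p))"
  shows "((G \<circ> chart_inv c) has_derivative (\<lambda>u. D (coord_change c d p u))) (at (snd c p))"
proof -
  have cA: "c \<in> A" "p \<in> fst c" and dA: "d \<in> A" "p \<in> fst d"
    using c d unfolding charts_at_def by auto
  have "(snd d \<circ> chart_inv c) (snd c p) = snd d p"
    by (simp add: chart_inv_of_chart[OF M cA])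
  with G have "((G \<circ> chart_inv d) has_derivative D) (at ((snd d \<circ> chart_inv c) (snd c p)))"
    by simp
  from has_derivative_compose[OF coord_change_has_derivative(1)[OF M c d] this]
  show ?thesis
    by (rule has_derivative_cong_open[OF _ open_chart_overlap[OF M cA(1) dA(1)]])
       (use cA dA in \<open>auto simp: chart_inv_of_chart[OF M cA(1)] chart_inv_of_chart[OF M dA(1)]\<close>)
qed

lemma coord_change_trans:
  assumes M: "complex_manifold X A" and c: "c \<in> charts_at A p" and d: "d \<in> charts_at A p"
    and e: "e \<in> charts_at A p"
  shows "coord_change c e p u = coord_change d e p (coord_change c d p u)"
  using has_derivative_unique[OF coord_change_has_derivative(1)[OF M c e]
    has_derivative_change_chart[OF M c d coord_change_has_derivative(1)[OF M d e]]]
  by (rule fun_cong)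

lemma tangent_space_coord_change:
  assumes "v \<in> tangent_space A p" "c \<in> charts_at A p" "d \<in> charts_at A p"
  shows "v d = coord_change c d p (v c)"
  using assms unfolding tangent_space_def by blast

lemma tangent_space_outside:
  assumes "v \<in> tangent_space A p" "c \<notin> charts_at A p" shows "v c = 0"
  using assms unfolding tangent_space_def by blast

lemma tangent_spaceI:
  assumes "\<And>c d. c \<in> charts_at A p \<Longrightarrow> d \<in> charts_at A p \<Longrightarrow> coord_change c d p (v c) = v d"
    and "\<And>c. c \<notin> charts_at A p \<Longrightarrow> v c = 0"
  shows "v \<in> tangent_space A p"
  using assms unfolding tangent_space_def by force

lemma tangent_space_0:
  assumes "complex_manifold X A" shows "(\<lambda>c. 0) \<in> tangent_space A p"
  by (rule tangent_spaceI) (simp_all add: linear_0[OF coord_change_linear[OF assms]])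

lemma tangent_space_add:
  assumes M: "complex_manifold X A" and "v \<in> tangent_space A p" "w \<in> tangent_space A p"
  shows "(\<lambda>c. v c + w c) \<in> tangent_space A p"
  by (rule tangent_spaceI)
     (simp_all add: linear_add[OF coord_change_linear[OF M]] tangent_space_outside[OF assms(2)]
       tangent_space_outside[OF assms(3)] flip: tangent_space_coord_change[OF assms(2)]
       tangent_space_coord_change[OF assms(3)])

lemma tangent_space_scale:
  assumes M: "complex_manifold X A" and "v \<in> tangent_space A p"
  shows "(\<lambda>c. k *s v c) \<in> tangent_space A p"
  by (rule tangent_spaceI)
     (simp_all add: coord_change_has_derivative(2)[OF M] tangent_space_outside[OF assms(2)]
       flip: tangent_space_coord_change[OF assms(2)])

lemma tangent_space_sum:
  assumes M: "complex_manifold X A" and "finite F" "\<And>j. j \<in> F \<Longrightarrow> v j \<in> tangent_space A p"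
  shows "(\<lambda>c. \<Sum>j\<in>F. k j *s v j c) \<in> tangent_space A p"
  using assms(2,3)
proof (induction F)
  case (insert j F)
  then show ?case
    using tangent_space_add[OF M tangent_space_scale[OF M]] by simp
qed (simp add: tangent_space_0[OF M])

lemma linear_on_tangent_0:
  assumes "complex_manifold X A" "linear_on_tangent A p l" shows "l (\<lambda>c. 0) = 0"
proof -
  have "l (\<lambda>c. 0 *s 0) = 0 * l (\<lambda>c. 0)"
    using assms(2) tangent_space_0[OF assms(1), of p] unfolding linear_on_tangent_def by fast
  then show ?thesis by simp
qed

lemma linear_on_tangent_sum:
  assumes M: "complex_manifold X A" and l: "linear_on_tangent A p l"
    and "finite F" "\<And>j. j \<in> F \<Longrightarrow> v j \<in> tangent_space A p"
  shows "l (\<lambda>c. \<Sum>j\<in>F. k j *s v j c) = (\<Sum>j\<in>F. k j * l (v j))"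
  using assms(3,4)
proof (induction F)
  case empty
  then show ?case using linear_on_tangent_0[OF M l] by simp
next
  case (insert j F)
  have "(\<lambda>c. k j *s v j c) \<in> tangent_space A p" "(\<lambda>c. \<Sum>j\<in>F. k j *s v j c) \<in> tangent_space A p"
    "v j \<in> tangent_space A p"
    using insert by (auto intro: tangent_space_scale[OF M] tangent_space_sum[OF M])
  then show ?case using l insert unfolding linear_on_tangent_def by simp
qed

text \<open>This is the cocycle rule for coordinate changes.\<close>

lemma coord_vec_tangent:
  assumes M: "complex_manifold X A" and c: "c \<in> charts_at A p"
  shows "coord_vec A c i p \<in> tangent_space A p"
  by (rule tangent_spaceI) (simp_all add: coord_vec_def flip: coord_change_trans[OF M c])

lemma tangent_vector_expansion:
  assumes M: "complex_manifold X A" and c: "c \<in> charts_at A p" and v: "v \<in> tangent_space A p"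
  shows "v = (\<lambda>d. \<Sum>i\<in>UNIV. (v c $ i) *s coord_vec A c i p d)"
proof
  fix d
  show "v d = (\<Sum>i\<in>UNIV. (v c $ i) *s coord_vec A c i p d)"
  proof (cases "d \<in> charts_at A p")
    case True
    have "v d = coord_change c d p (\<Sum>i\<in>UNIV. (v c $ i) *s axis i 1)"
      using tangent_space_coord_change[OF v c True] vec_eq_sum_axis[of "v c"] by simp
    also have "\<dots> = (\<Sum>i\<in>UNIV. (v c $ i) *s coord_change c d p (axis i 1))"
      by (simp add: linear_sum[OF coord_change_linear[OF M c True]]
          coord_change_has_derivative(2)[OF M c True])
    finally show ?thesis using True by (simp add: coord_vec_def)
  next
    case False
    then show ?thesis by (simp add: coord_vec_def tangent_space_outside[OF v])
  qed
qed

lemma vector_fields_tangent: "V \<in> vector_fields A \<Longrightarrow> V p \<in> tangent_space A p"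
  unfolding vector_fields_def by blast

lemma vector_fields_0:
  assumes "complex_manifold X A" shows "(\<lambda>p c. 0) \<in> vector_fields A"
  unfolding vector_fields_def holo_map_on_def vf_coords_def
  using tangent_space_0[OF assms] by (auto intro: holo_on_const)

lemma vector_fields_add:
  assumes "complex_manifold X A" "V \<in> vector_fields A" "W \<in> vector_fields A"
  shows "(\<lambda>p c. V p c + W p c) \<in> vector_fields A"
  using assms(2,3) unfolding vector_fields_def holo_map_on_def vf_coords_def
  by (auto intro: holo_on_add tangent_space_add[OF assms(1)])

lemma vector_fields_scale:
  assumes "complex_manifold X A" "V \<in> vector_fields A"
  shows "(\<lambda>p c. k *s V p c) \<in> vector_fields A"
  using assms(2) unfolding vector_fields_def holo_map_on_def vf_coords_def
  by (auto intro: holo_on_mult holo_on_const tangent_space_scale[OF assms(1)])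

lemma holo_functions_0: "(\<lambda>p. 0) \<in> holo_functions A"
  unfolding holo_functions_def by (auto simp: comp_def holo_on_const)

lemma holo_functions_add:
  "f \<in> holo_functions A \<Longrightarrow> g \<in> holo_functions A \<Longrightarrow> (\<lambda>p. f p + g p) \<in> holo_functions A"
  unfolding holo_functions_def by (auto simp: comp_def holo_on_add)

lemma holo_functions_cmult:
  "f \<in> holo_functions A \<Longrightarrow> (\<lambda>p. k * f p) \<in> holo_functions A"
  unfolding holo_functions_def by (auto simp: comp_def holo_on_mult holo_on_const)

lemma holo_function_has_derivative:
  assumes "f \<in> holo_functions A" "c \<in> charts_at A p"
  shows "((f \<circ> chart_inv c) has_derivative frechet_derivative (f \<circ> chart_inv c) (at (snd c p)))
      (at (snd c p))"
  by (rule holo_on_derivative(1)[of _ "chart_image c"])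
     (use assms in \<open>auto simp: holo_functions_def charts_at_def chart_image_memI\<close>)

text \<open>The definition of \<open>diff\<close> picks some chart; the transformation law of tangent vectors cancels
  the chain rule, so any other chart gives the same value.\<close>

lemma diff_in_chart:
  assumes M: "complex_manifold X A" and f: "f \<in> holo_functions A" and c: "c \<in> charts_at A p"
    and v: "v \<in> tangent_space A p"
  shows "diff X A f p v = frechet_derivative (f \<circ> chart_inv c) (at (snd c p)) (v c)"
proof -
  define d where "d = (SOME d. d \<in> charts_at A p)"
  have d: "d \<in> charts_at A p" unfolding d_def using c by (rule someI)
  have "p \<in> topspace X" using chart_mem_topspace[OF M, of c p] c by (simp add: charts_at_def)
  then have "diff X A f p v = frechet_derivative (f \<circ> chart_inv d) (at (snd d p)) (v d)"
    using v by (simp add: diff_def d_def Let_def)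
  also have "\<dots> = frechet_derivative (f \<circ> chart_inv c) (at (snd c p)) (v c)"
    using frechet_derivative_at[OF has_derivative_change_chart[OF M c d
          holo_function_has_derivative[OF f d]], THEN fun_cong, of "v c"]
    by (simp only: tangent_space_coord_change[OF v c d])
  finally show ?thesis .
qed

lemma diff_outside: "p \<notin> topspace X \<or> v \<notin> tangent_space A p \<Longrightarrow> diff X A f p v = 0"
  by (auto simp: diff_def)

lemma diff_0: "diff X A (\<lambda>p. 0) p v = 0"
  by (simp add: diff_def comp_def)

lemma diff_add:
  assumes M: "complex_manifold X A" and f: "f \<in> holo_functions A" and g: "g \<in> holo_functions A"
  shows "diff X A (\<lambda>p. f p + g p) p v = diff X A f p v + diff X A g p v"
proof (cases "p \<in> topspace X \<and> v \<in> tangent_space A p")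
  case True
  then obtain c where c: "c \<in> charts_at A p" using chart_exists[OF M] by blast
  have v: "v \<in> tangent_space A p" using True by blast
  show ?thesis
    unfolding diff_in_chart[OF M f c v] diff_in_chart[OF M g c v]
      diff_in_chart[OF M holo_functions_add[OF f g] c v]
    using frechet_derivative_at[OF has_derivative_add[OF holo_function_has_derivative[OF f c]
      holo_function_has_derivative[OF g c]], THEN fun_cong, of "v c"]
    by (simp only: comp_def)
qed (auto simp: diff_outside)

lemma diff_cmult:
  assumes M: "complex_manifold X A" and f: "f \<in> holo_functions A"
  shows "diff X A (\<lambda>p. k * f p) p v = k * diff X A f p v"
proof (cases "p \<in> topspace X \<and> v \<in> tangent_space A p")
  case True
  then obtain c where c: "c \<in> charts_at A p" using chart_exists[OF M] by blast
  have v: "v \<in> tangent_space A p" using True by blast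
  show ?thesis
    unfolding diff_in_chart[OF M f c v] diff_in_chart[OF M holo_functions_cmult[OF f] c v]
    using frechet_derivative_at[OF has_derivative_mult_right[OF holo_function_has_derivative[OF f c]],
      THEN fun_cong, of k "v c"]
    by (simp only: comp_def)
qed (auto simp: diff_outside)

lemma diff_lincomb:
  assumes M: "complex_manifold X A" and "finite F" "\<And>j. j \<in> F \<Longrightarrow> f j \<in> holo_functions A"
  shows "(\<lambda>p. \<Sum>j\<in>F. k j * f j p) \<in> holo_functions A \<and>
    (\<forall>p v. diff X A (\<lambda>p. \<Sum>j\<in>F. k j * f j p) p v = (\<Sum>j\<in>F. k j * diff X A (f j) p v))"
  using assms(2,3)
proof (induction F)
  case (insert j F)
  then have "f j \<in> holo_functions A" "(\<lambda>p. \<Sum>j\<in>F. k j * f j p) \<in> holo_functions A"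
    by simp_all
  then show ?case
    using insert
    by (simp add: holo_functions_add holo_functions_cmult diff_add[OF M] diff_cmult[OF M])
qed (simp add: holo_functions_0 diff_0)

lemma coord_vec_same_chart:
  assumes M: "complex_manifold X A" and c: "c \<in> charts_at A p"
  shows "coord_vec A c i p c = axis i 1"
proof -
  have cA: "c \<in> A" "p \<in> fst c" using c by (auto simp: charts_at_def)
  have "((snd c \<circ> chart_inv c) has_derivative (\<lambda>u. u)) (at (snd c p))"
    by (rule has_derivative_cong_open[OF has_derivative_ident open_chart_image[OF M cA(1)]])
       (auto simp: cA chart_image_memI chart_of_chart_inv)
  from has_derivative_unique[OF coord_change_has_derivative(1)[OF M c c] this]
  show ?thesis using c by (simp add: coord_vec_def)
qed

lemma charts_at_chart_inv: "c \<in> A \<Longrightarrow> z \<in> chart_image c \<Longrightarrow> c \<in> charts_at A (chart_inv c z)"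
  by (simp add: charts_at_def chart_inv_mem)

lemma form1_coeff_diff:
  assumes M: "complex_manifold X A" and f: "f \<in> holo_functions A" and c: "c \<in> A"
    and z: "z \<in> chart_image c"
  shows "form1_coeff A (diff X A f) c i z = partial i (f \<circ> chart_inv c) z"
proof -
  note c' = charts_at_chart_inv[OF c z]
  show ?thesis
    by (simp add: form1_coeff_def diff_in_chart[OF M f c' coord_vec_tangent[OF M c']]
        coord_vec_same_chart[OF M c'] chart_of_chart_inv[OF z] partial_def)
qed

text \<open>In a chart the coefficients of \<open>df\<close> are the partial derivatives of \<open>f\<close>, and these commute.\<close>

lemma closed_diff:
  assumes M: "complex_manifold X A" and f: "f \<in> holo_functions A"
  shows "closed_1form A (diff X A f)"
  unfolding closed_1form_def
proof (intro ballI allI)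
  fix c z i j assume c: "c \<in> A" and z: "z \<in> chart_image c"
  note o = open_chart_image[OF M c]
  have h: "holo_on (f \<circ> chart_inv c) (chart_image c)" using f c by (simp add: holo_functions_def)
  have "partial i (form1_coeff A (diff X A f) c j) z = partial i (partial j (f \<circ> chart_inv c)) z" for i j
    by (rule partial_cong_open[OF o z]) (rule form1_coeff_diff[OF M f c])
  then show "partial i (form1_coeff A (diff X A f) c j) z = partial j (form1_coeff A (diff X A f) c i) z"
    using partial_commute[OF h o z, of i j] by simp
qed

lemma HVF_subset_SVF:
  assumes "complex_manifold X A" shows "HVF X A \<omega> \<subseteq> SVF A \<omega>"
  unfolding HVF_def SVF_def using closed_diff[OF assms] by auto

section \<open>Linear combinations of symplectic vector fields\<close>

definition vf_lincomb :: "'j set \<Rightarrow> ('j \<Rightarrow> complex) \<Rightarrow> ('j \<Rightarrow> ('a, 'n::finite) vfield) \<Rightarrow> ('a, 'n) vfield"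
  where "vf_lincomb F k V p c = (\<Sum>j\<in>F. k j *s V j p c)"

lemma vf_lincomb_empty: "vf_lincomb {} k V = (\<lambda>p c. 0)"
  by (simp add: vf_lincomb_def fun_eq_iff)

lemma vf_lincomb_insert:
  "finite F \<Longrightarrow> j \<notin> F \<Longrightarrow>
    vf_lincomb (insert j F) k V = (\<lambda>p c. k j *s V j p c + vf_lincomb F k V p c)"
  by (simp add: vf_lincomb_def fun_eq_iff)

lemma flat_outside:
  assumes "\<omega> \<in> holo_2forms X A" "p \<notin> topspace X \<or> v \<notin> tangent_space A p"
  shows "flat \<omega> V p v = 0"
  using assms unfolding holo_2forms_def flat_def by blast

lemma flat_linear_on_tangent:
  assumes "\<omega> \<in> holo_2forms X A" "p \<in> topspace X" "v \<in> tangent_space A p"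
  shows "linear_on_tangent A p (\<lambda>w. \<omega> p w v)"
  using assms unfolding holo_2forms_def by blast

lemma flat_add:
  assumes \<omega>: "\<omega> \<in> holo_2forms X A" and V: "V \<in> vector_fields A" and W: "W \<in> vector_fields A"
  shows "flat \<omega> (\<lambda>p c. V p c + W p c) = (\<lambda>p v. flat \<omega> V p v + flat \<omega> W p v)"
proof (intro ext)
  fix p v
  show "flat \<omega> (\<lambda>p c. V p c + W p c) p v = flat \<omega> V p v + flat \<omega> W p v"
  proof (cases "p \<in> topspace X \<and> v \<in> tangent_space A p")
    case True
    then show ?thesis
      using flat_linear_on_tangent[OF \<omega>, of p v] vector_fields_tangent[OF V, of p]
        vector_fields_tangent[OF W, of p]
      unfolding linear_on_tangent_def flat_def by blast
  qed (simp add: flat_outside[OF \<omega>])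
qed

lemma flat_scale:
  assumes \<omega>: "\<omega> \<in> holo_2forms X A" and V: "V \<in> vector_fields A"
  shows "flat \<omega> (\<lambda>p c. k *s V p c) = (\<lambda>p v. k * flat \<omega> V p v)"
proof (intro ext)
  fix p v
  show "flat \<omega> (\<lambda>p c. k *s V p c) p v = k * flat \<omega> V p v"
  proof (cases "p \<in> topspace X \<and> v \<in> tangent_space A p")
    case True
    then show ?thesis
      using flat_linear_on_tangent[OF \<omega>, of p v] vector_fields_tangent[OF V, of p]
      unfolding linear_on_tangent_def flat_def by blast
  qed (simp add: flat_outside[OF \<omega>])
qed

lemma flat_0:
  assumes M: "complex_manifold X A" and \<omega>: "\<omega> \<in> holo_2forms X A"
  shows "flat \<omega> (\<lambda>p c. 0) = (\<lambda>p v. 0)"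
  using flat_scale[OF \<omega> vector_fields_0[OF M], of 0] by simp

lemma vf_lincomb_vector_field:
  assumes M: "complex_manifold X A" and \<omega>: "\<omega> \<in> holo_2forms X A"
    and "finite F" "\<And>j. j \<in> F \<Longrightarrow> V j \<in> vector_fields A"
  shows "vf_lincomb F k V \<in> vector_fields A \<and>
    flat \<omega> (vf_lincomb F k V) = (\<lambda>p v. \<Sum>j\<in>F. k j * flat \<omega> (V j) p v)"
  using assms(3,4)
proof (induction F)
  case (insert j F)
  then have j: "V j \<in> vector_fields A" and IH: "vf_lincomb F k V \<in> vector_fields A"
    "flat \<omega> (vf_lincomb F k V) = (\<lambda>p v. \<Sum>j\<in>F. k j * flat \<omega> (V j) p v)" by auto
  then show ?case
    using insert(1,2) vector_fields_add[OF M vector_fields_scale[OF M j] IH(1)]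
      flat_add[OF \<omega> vector_fields_scale[OF M j] IH(1)]
    by (simp add: vf_lincomb_insert flat_scale[OF \<omega> j])
qed (simp add: vf_lincomb_empty vector_fields_0[OF M] flat_0[OF M \<omega>])

text \<open>Expanding \<open>V\<close> in coordinate vectors; consequently \<open>flat \<omega> V\<close> has holomorphic coefficients.\<close>

lemma form1_coeff_flat:
  assumes M: "complex_manifold X A" and \<omega>: "\<omega> \<in> holo_2forms X A" and V: "V \<in> vector_fields A"
    and c: "c \<in> A" and z: "z \<in> chart_image c"
  shows "form1_coeff A (flat \<omega> V) c j z =
    (\<Sum>i\<in>UNIV. vf_coords V c z $ i * form2_coeff A \<omega> c i j z)"
proof -
  let ?p = "chart_inv c z"
  note c' = charts_at_chart_inv[OF c z]
  have p: "?p \<in> topspace X" using chart_mem_topspace[OF M c chart_inv_mem[OF z]] .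
  let ?l = "\<lambda>w. \<omega> ?p w (coord_vec A c j ?p)"
  have "?l (V ?p) = ?l (\<lambda>d. \<Sum>i\<in>UNIV. (V ?p c $ i) *s coord_vec A c i ?p d)"
    using tangent_vector_expansion[OF M c' vector_fields_tangent[OF V]] by simp
  also have "\<dots> = (\<Sum>i\<in>UNIV. V ?p c $ i * ?l (coord_vec A c i ?p))"
    by (rule linear_on_tangent_sum[OF M flat_linear_on_tangent[OF \<omega> p coord_vec_tangent[OF M c']]])
       (simp_all add: coord_vec_tangent[OF M c'])
  finally show ?thesis
    by (simp add: form1_coeff_def form2_coeff_def flat_def vf_coords_def Let_def)
qed

lemma flat_holo_1form:
  assumes M: "complex_manifold X A" and \<omega>: "\<omega> \<in> holo_2forms X A" and V: "V \<in> vector_fields A"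
  shows "flat \<omega> V \<in> holo_1forms X A"
proof -
  have "linear_on_tangent A p (flat \<omega> V p)" if "p \<in> topspace X" for p
    using that \<omega> vector_fields_tangent[OF V, of p]
    unfolding holo_2forms_def flat_def[abs_def] by blast
  moreover have "holo_on (form1_coeff A (flat \<omega> V) c j) (chart_image c)" if c: "c \<in> A" for c j
  proof (rule holo_on_cong_open[OF open_chart_image[OF M c] form1_coeff_flat[OF M \<omega> V c, symmetric]])
    show "holo_on (\<lambda>z. \<Sum>i\<in>UNIV. vf_coords V c z $ i * form2_coeff A \<omega> c i j z) (chart_image c)"
      using V \<omega> c
      by (intro holo_on_sum holo_on_mult)
         (auto simp: vector_fields_def holo_map_on_def holo_2forms_def)
  qed
  ultimately show ?thesis
    unfolding holo_1forms_def using flat_outside[OF \<omega>] by blast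
qed

lemma holo_1forms_coeff:
  "\<alpha> \<in> holo_1forms X A \<Longrightarrow> c \<in> A \<Longrightarrow> holo_on (form1_coeff A \<alpha> c i) (chart_image c)"
  unfolding holo_1forms_def by blast

lemma closed_1form_add:
  assumes \<alpha>: "\<alpha> \<in> holo_1forms X A" "closed_1form A \<alpha>" and \<beta>: "\<beta> \<in> holo_1forms X A" "closed_1form A \<beta>"
  shows "closed_1form A (\<lambda>p v. \<alpha> p v + \<beta> p v)"
proof -
  have e: "form1_coeff A (\<lambda>p v. \<alpha> p v + \<beta> p v) c i =
      (\<lambda>z. form1_coeff A \<alpha> c i z + form1_coeff A \<beta> c i z)" for c i
    by (simp add: form1_coeff_def fun_eq_iff Let_def)
  show ?thesis
    using \<alpha>(2) \<beta>(2) unfolding closed_1form_def e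
    by (simp add: partial_add[OF holo_1forms_coeff[OF \<alpha>(1)] holo_1forms_coeff[OF \<beta>(1)]])
qed

lemma closed_1form_cmult:
  assumes \<alpha>: "\<alpha> \<in> holo_1forms X A" "closed_1form A \<alpha>"
  shows "closed_1form A (\<lambda>p v. k * \<alpha> p v)"
proof -
  have e: "form1_coeff A (\<lambda>p v. k * \<alpha> p v) c i = (\<lambda>z. k * form1_coeff A \<alpha> c i z)" for c i
    by (simp add: form1_coeff_def fun_eq_iff Let_def)
  show ?thesis
    using \<alpha>(2) unfolding closed_1form_def e
    by (simp add: partial_cmult[OF holo_1forms_coeff[OF \<alpha>(1)]])
qed

lemma SVF_closed_1form:
  assumes "complex_manifold X A" "\<omega> \<in> holo_2forms X A" "V \<in> SVF A \<omega>"
  shows "flat \<omega> V \<in> holo_1forms X A" "closed_1form A (flat \<omega> V)"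
  using flat_holo_1form[OF assms(1,2)] assms(3) unfolding SVF_def by auto

lemma SVF_add:
  assumes M: "complex_manifold X A" and \<omega>: "\<omega> \<in> holo_2forms X A"
    and V: "V \<in> SVF A \<omega>" and W: "W \<in> SVF A \<omega>"
  shows "(\<lambda>p c. V p c + W p c) \<in> SVF A \<omega>"
  using closed_1form_add[OF SVF_closed_1form[OF M \<omega> V] SVF_closed_1form[OF M \<omega> W]]
    vector_fields_add[OF M, of V W] flat_add[OF \<omega>, of V W] V W
  unfolding SVF_def by simp

lemma SVF_scale:
  assumes M: "complex_manifold X A" and \<omega>: "\<omega> \<in> holo_2forms X A" and V: "V \<in> SVF A \<omega>"
  shows "(\<lambda>p c. k *s V p c) \<in> SVF A \<omega>"
  using closed_1form_cmult[OF SVF_closed_1form[OF M \<omega> V]]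
    vector_fields_scale[OF M, of V] flat_scale[OF \<omega>, of V] V
  unfolding SVF_def by simp

lemma SVF_0:
  assumes M: "complex_manifold X A" and \<omega>: "\<omega> \<in> holo_2forms X A"
  shows "(\<lambda>p c. 0) \<in> SVF A \<omega>"
proof -
  have "closed_1form A (diff X A (\<lambda>p. 0))" by (rule closed_diff[OF M holo_functions_0])
  moreover have "diff X A (\<lambda>p. 0) = (\<lambda>p v. 0)" by (intro ext diff_0)
  ultimately show ?thesis
    unfolding SVF_def using vector_fields_0[OF M] flat_0[OF M \<omega>] by simp
qed

lemma vf_lincomb_SVF:
  assumes M: "complex_manifold X A" and \<omega>: "\<omega> \<in> holo_2forms X A"
    and "finite F" "\<And>j. j \<in> F \<Longrightarrow> V j \<in> SVF A \<omega>"
  shows "vf_lincomb F k V \<in> SVF A \<omega>"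
  using assms(3,4)
proof (induction F)
  case (insert j F)
  then show ?case
    using SVF_add[OF M \<omega> SVF_scale[OF M \<omega>]] by (simp add: vf_lincomb_insert)
qed (simp add: vf_lincomb_empty SVF_0[OF M \<omega>])

section \<open>Generated Lie algebras and the topology of vector fields\<close>

lemma vf_lincomb_lie_generated:
  assumes "finite F" "\<And>j. j \<in> F \<Longrightarrow> V j \<in> S"
  shows "vf_lincomb F k V \<in> lie_generated A S"
  using assms
proof (induction F)
  case (insert j F)
  then show ?case
    by (simp add: vf_lincomb_insert lie_generated.add lie_generated.scale lie_generated.gen)
qed (simp add: vf_lincomb_empty lie_generated.zero)

lemma lie_generated_mono:
  assumes "S \<subseteq> T" shows "lie_generated A S \<subseteq> lie_generated A T"
proof
  fix V assume "V \<in> lie_generated A S"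
  then show "V \<in> lie_generated A T"
    by induction (use assms in \<open>auto intro: lie_generated.intros\<close>)
qed

lemma topspace_vf_topology: "topspace (vf_topology X A) = vector_fields A"
  unfolding vf_topology_def by auto

text \<open>Translation by \<open>S\<close> pulls the subbasic neighbourhood of \<open>V\<close> given by a chart, a compact set and
  a bound \<open>e\<close> back to the one of \<open>V - S\<close> given by the same data.\<close>

lemma continuous_map_vf_translation:
  assumes M: "complex_manifold X A" and S: "S \<in> vector_fields A"
  shows "continuous_map (vf_topology X A) (vf_topology X A) (\<lambda>W p c. W p c + S p c)"
proof -
  let ?f = "\<lambda>W p c. W p c + S p c"
  have add: "?f W \<in> vector_fields A" if "W \<in> vector_fields A" for W
    by (rule vector_fields_add[OF M that S])
  have "continuous_map (vf_topology X A) (topology_generated_by (insert (vector_fields A)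
     {{W \<in> vector_fields A. \<forall>p\<in>K. norm (W p c - V p c) < e} | V c K e.
        V \<in> vector_fields A \<and> c \<in> A \<and> compactin X K \<and> K \<subseteq> fst c \<and> e > 0})) ?f"
  proof (rule continuous_on_generated_topo; (elim insertE CollectE exE conjE)?)
    fix U assume "U = vector_fields A"
    then have "?f -` U \<inter> topspace (vf_topology X A) = topspace (vf_topology X A)"
      using add by (auto simp: topspace_vf_topology)
    then show "openin (vf_topology X A) (?f -` U \<inter> topspace (vf_topology X A))" by simp
  next
    fix U V c K and e :: real
    assume U: "U = {W \<in> vector_fields A. \<forall>p\<in>K. norm (W p c - V p c) < e}"
      and V: "V \<in> vector_fields A" and c: "c \<in> A" "compactin X K" "K \<subseteq> fst c" "e > 0"
    \<comment> \<open>The difference is written as a sum so that closure under addition and scaling applies.\<close>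
    let ?V = "\<lambda>p c. V p c + (-1) *s S p c"
    have V': "?V \<in> vector_fields A"
      by (rule vector_fields_add[OF M V vector_fields_scale[OF M S]])
    have eq: "W p c + S p c - V p c = W p c - ?V p c" for W p
      by (simp add: vec_eq_iff)
    have e: "?f -` U \<inter> topspace (vf_topology X A) =
        {W \<in> vector_fields A. \<forall>p\<in>K. norm (W p c - ?V p c) < e}"
      unfolding U eq[symmetric] using add by (auto simp: topspace_vf_topology)
    show "openin (vf_topology X A) (?f -` U \<inter> topspace (vf_topology X A))"
      unfolding e unfolding vf_topology_def
      by (rule topology_generated_by_Basis, rule insertI2, rule CollectI)
         (intro exI conjI, rule refl, fact+)
  next
    show "?f ` topspace (vf_topology X A) \<subseteq> \<Union> (insert (vector_fields A)
     {{W \<in> vector_fields A. \<forall>p\<in>K. norm (W p c - V p c) < e} | V c K e.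
        V \<in> vector_fields A \<and> c \<in> A \<and> compactin X K \<and> K \<subseteq> fst c \<and> e > 0})"
      using add by (auto simp: topspace_vf_topology)
  qed
  then show ?thesis by (simp add: vf_topology_def)
qed

section \<open>The symplectic density property\<close>

lemma dR_relD:
  assumes "(\<alpha>, \<beta>) \<in> dR_rel X A"
  shows "\<exists>f. f \<in> holo_functions A \<and> (\<forall>p v. \<alpha> p v - \<beta> p v = diff X A f p v)"
proof -
  obtain f where "f \<in> holo_functions A" and e: "(\<lambda>p v. \<alpha> p v - \<beta> p v) = diff X A f"
    using assms unfolding dR_rel_def by auto
  then show ?thesis using fun_cong[OF fun_cong[OF e]] by blast
qed

text \<open>Write the class of \<open>flat \<omega> W\<close> as a finite combination of the basis classes. The representatives
  in that combination differ from the \<open>flat \<omega> (V j)\<close> by exact forms, so \<open>flat \<omega>\<close> of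
  \<open>W - (\<Sum>j\<in>F. k j V j)\<close> is exact.\<close>

lemma symplectic_decomposition:
  assumes M: "complex_manifold X A" and \<omega>: "\<omega> \<in> holo_2forms X A"
    and V: "\<And>j. j \<in> J \<Longrightarrow> V j \<in> SVF A \<omega>"
    and basis: "dR_basis X A J (\<lambda>j. dR_class X A (flat \<omega> (V j)))"
    and W: "W \<in> SVF A \<omega>"
  obtains F k H where "finite F" "F \<subseteq> J" "H \<in> HVF X A \<omega>"
    "W = (\<lambda>p c. H p c + vf_lincomb F k V p c)"
proof -
  have WV: "W \<in> vector_fields A" using W by (simp add: SVF_def)
  have cl: "flat \<omega> U \<in> closed_1forms X A" if "U \<in> SVF A \<omega>" for U
    using SVF_closed_1form[OF M \<omega> that] by (simp add: closed_1forms_def)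
  have "dR_class X A (flat \<omega> W) \<in> H1_dR X A"
    unfolding dR_class_def H1_dR_def by (rule quotientI[OF cl[OF W]])
  then obtain F k where F: "finite F" "F \<subseteq> J" and
    eq: "dR_class X A (flat \<omega> W) = dR_lincomb X A F k (\<lambda>j. dR_class X A (flat \<omega> (V j)))"
    using basis[unfolded dR_basis_def, THEN conjunct2, THEN conjunct2, THEN bspec] by metis
  have "diff X A (\<lambda>p. 0) = (\<lambda>p v. 0)" by (intro ext diff_0)
  then have "(flat \<omega> W, flat \<omega> W) \<in> dR_rel X A"
    using cl[OF W] holo_functions_0[of A] by (auto simp: dR_rel_def intro!: bexI[of _ "\<lambda>p. 0"])
  then have "flat \<omega> W \<in> dR_lincomb X A F k (\<lambda>j. dR_class X A (flat \<omega> (V j)))"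
    unfolding eq[symmetric] by (simp add: dR_class_def)
  then obtain a where a: "\<And>j. j \<in> F \<Longrightarrow> (flat \<omega> (V j), a j) \<in> dR_rel X A"
    and aW: "((\<lambda>p v. \<Sum>j\<in>F. k j * a j p v), flat \<omega> W) \<in> dR_rel X A"
    unfolding dR_lincomb_def dR_class_def by auto
  from dR_relD[OF a] have "\<forall>j\<in>F. \<exists>f. f \<in> holo_functions A \<and>
      (\<forall>p v. flat \<omega> (V j) p v - a j p v = diff X A f p v)"
    by simp
  from bchoice[OF this] obtain f where f: "\<And>j. j \<in> F \<Longrightarrow> f j \<in> holo_functions A"
    "\<And>j p v. j \<in> F \<Longrightarrow> flat \<omega> (V j) p v - a j p v = diff X A (f j) p v"
    by auto
  from dR_relD[OF aW] obtain g where g: "g \<in> holo_functions A"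
    "\<And>p v. (\<Sum>j\<in>F. k j * a j p v) - flat \<omega> W p v = diff X A g p v"
    by auto
  define S where "S = vf_lincomb F k V"
  have S: "S \<in> vector_fields A" "flat \<omega> S = (\<lambda>p v. \<Sum>j\<in>F. k j * flat \<omega> (V j) p v)"
    using vf_lincomb_vector_field[OF M \<omega> F(1), of V k] V F(2) unfolding S_def SVF_def by auto
  define H where "H = (\<lambda>p c. W p c + (-1) *s S p c)"
  have H: "H \<in> vector_fields A"
    unfolding H_def by (rule vector_fields_add[OF M WV vector_fields_scale[OF M S(1)]])
  \<comment> \<open>With \<open>\<alpha> j = flat \<omega> (V j)\<close>: \<open>flat \<omega> W = (\<Sum>j\<in>F. k j a j) - dg\<close> and
    \<open>a j = \<alpha> j - d(f j)\<close>, so \<open>flat \<omega> W - (\<Sum>j\<in>F. k j \<alpha> j) = - d (g + (\<Sum>j\<in>F. k j f j))\<close>.\<close>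
  let ?s = "\<lambda>p. \<Sum>j\<in>F. k j * f j p"
  have s: "?s \<in> holo_functions A" "\<And>p v. diff X A ?s p v = (\<Sum>j\<in>F. k j * diff X A (f j) p v)"
    using diff_lincomb[OF M F(1) f(1), of "\<lambda>j. j" k] by auto
  let ?h = "\<lambda>p. (-1) * (g p + ?s p)"
  have h: "?h \<in> holo_functions A"
    by (intro holo_functions_cmult holo_functions_add g s)
  have "flat \<omega> H p v = diff X A ?h p v" for p v
  proof -
    have "diff X A ?h p v = - (diff X A g p v + (\<Sum>j\<in>F. k j * diff X A (f j) p v))"
      unfolding diff_cmult[OF M holo_functions_add[OF g(1) s(1)]] diff_add[OF M g(1) s(1)] s(2)
      by simp
    also have "(\<Sum>j\<in>F. k j * diff X A (f j) p v) =
        (\<Sum>j\<in>F. k j * flat \<omega> (V j) p v) - (\<Sum>j\<in>F. k j * a j p v)"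
      unfolding sum_subtractf[symmetric]
      by (rule sum.cong) (simp_all add: algebra_simps flip: f(2))
    finally show ?thesis
      unfolding H_def flat_add[OF \<omega> WV vector_fields_scale[OF M S(1)]] flat_scale[OF \<omega> S(1)] S(2)
        g(2)[symmetric]
      by simp
  qed
  then have "H \<in> HVF X A \<omega>" unfolding HVF_def using H h by blast
  moreover have "W = (\<lambda>p c. H p c + S p c)" by (simp add: H_def fun_eq_iff vec_eq_iff)
  ultimately show thesis using that F unfolding S_def by blast
qed

theorem proposition2p8:
  fixes X :: "'a topology"
    and A :: "('a, 'n::finite) chart set"
    and \<omega> :: "('a, 'n) form2"
    and J :: "'j set"
    and V :: "'j \<Rightarrow> ('a, 'n) vfield"
  assumes "stein_manifold X A"
    and "holo_symplectic_form X A \<omega>"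
    and "hamiltonian_density_property X A \<omega>"
    and "\<And>j. j \<in> J \<Longrightarrow> V j \<in> SVF A \<omega> \<and> complete_vf X A (V j)"
    and "dR_basis X A J (\<lambda>j. dR_class X A (flat \<omega> (V j)))"
  shows "symplectic_density_property X A \<omega>"
proof -
  have M: "complex_manifold X A" using assms(1) by (simp add: stein_manifold_def)
  have \<omega>: "\<omega> \<in> holo_2forms X A" using assms(2) by (simp add: holo_symplectic_form_def)
  let ?T = "vf_topology X A"
  let ?H = "{U \<in> HVF X A \<omega>. complete_vf X A U}" and ?S = "{U \<in> SVF A \<omega>. complete_vf X A U}"
  have HS: "lie_generated A ?H \<subseteq> lie_generated A ?S"
    by (rule lie_generated_mono) (use HVF_subset_SVF[OF M] in blast)
  have SVF: "topspace (subtopology ?T (SVF A \<omega>)) = SVF A \<omega>"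
    by (auto simp: topspace_vf_topology SVF_def)
  have "W \<in> subtopology ?T (SVF A \<omega>) closure_of lie_generated A ?S" if W: "W \<in> SVF A \<omega>" for W
    unfolding in_closure_of SVF
  proof (intro conjI W allI impI; elim conjE)
    fix U assume "W \<in> U" "openin (subtopology ?T (SVF A \<omega>)) U"
    then obtain U' where U': "openin ?T U'" "U = U' \<inter> SVF A \<omega>" "W \<in> U'"
      by (auto simp: openin_subtopology)
    obtain F k H where F: "finite F" "F \<subseteq> J" and H: "H \<in> HVF X A \<omega>"
      and WH: "W = (\<lambda>p c. H p c + vf_lincomb F k V p c)"
      by (rule symplectic_decomposition[OF M \<omega> _ assms(5) W]) (use assms(4) in auto)
    define S where "S = vf_lincomb F k V"
    have S: "S \<in> SVF A \<omega>" "S \<in> lie_generated A ?S"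
      unfolding S_def using F assms(4)
      by (auto intro!: vf_lincomb_SVF[OF M \<omega>] vf_lincomb_lie_generated)
    let ?f = "\<lambda>W p c. W p c + S p c"
    \<comment> \<open>The neighbourhood of \<open>W = H + S\<close> is moved to a neighbourhood of \<open>H\<close>, where the Hamiltonian
      density property provides an approximating field.\<close>
    define N where "N = {Y \<in> topspace ?T. ?f Y \<in> U'}"
    have "continuous_map ?T ?T ?f"
      by (rule continuous_map_vf_translation[OF M]) (use S in \<open>simp add: SVF_def\<close>)
    then have "openin ?T N"
      unfolding N_def using U'(1) by (rule openin_continuous_map_preimage)
    then have "openin (subtopology ?T (HVF X A \<omega>)) (N \<inter> HVF X A \<omega>)"
      by (rule openin_subtopology_Int)
    moreover have "H \<in> N \<inter> HVF X A \<omega>"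
      using H U'(3) unfolding WH S_def N_def by (simp add: topspace_vf_topology HVF_def)
    moreover have "H \<in> subtopology ?T (HVF X A \<omega>) closure_of lie_generated A ?H"
      using assms(3) H unfolding hamiltonian_density_property_def by simp
    ultimately have "\<exists>Y. Y \<in> lie_generated A ?H \<and> Y \<in> N \<inter> HVF X A \<omega>"
      unfolding in_closure_of by blast
    then obtain Y where Y: "Y \<in> lie_generated A ?H" "Y \<in> HVF X A \<omega>" "?f Y \<in> U'"
      unfolding N_def by auto
    have "?f Y \<in> SVF A \<omega>"
      using SVF_add[OF M \<omega> _ S(1)] HVF_subset_SVF[OF M] Y(2) by blast
    moreover have "?f Y \<in> lie_generated A ?S"
      using lie_generated.add[OF _ S(2)] HS Y(1) by blast
    ultimately show "\<exists>Y. Y \<in> lie_generated A ?S \<and> Y \<in> U"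
      using Y(3) U'(2) by blast
  qed
  moreover have "subtopology ?T (SVF A \<omega>) closure_of lie_generated A ?S \<subseteq> SVF A \<omega>"
    using closure_of_subset_topspace[of "subtopology ?T (SVF A \<omega>)"] SVF by simp
  ultimately show ?thesis
    unfolding symplectic_density_property_def by blast
qed

end
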